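(* Let $n\ge 1$, let $p_0,p_1,p_2\in\mathbb{R}[s]$ with $p_0$ monic of degree $n$, $\deg p_1<n$, $\deg p_2<n$, and with the ratio $p_1(s)/p_2(s)$ not a constant. Let $p(s,k)=p_0(s)+k_1p_1(s)+k_2p_2(s)$ for $k=(k_1,k_2)\in\mathbb{R}^2$, let $H(k)$ be the Hermite matrix of $p(\cdot,k)$, let $C(k)$ be the symmetric affine matrix pencil and $\mathcal{C}\subset\mathbb{R}^2$ the curve defined in the context, and let $\mathcal{S}_1,\dots,\mathcal{S}_N$ be the connected components of $\mathbb{R}^2\setminus\mathcal{C}$. If $H(k)\succ0$ and $C(k)\succ0$ for some point $k$ in the interior of $\mathcal{S}_i$, then $\mathcal{S}_i$ is an LMI region (that is, $\mathcal{S}_i=\{k\in\mathbb{R}^2: C(k)\succ0\}$) included in the stability region $\mathcal{S}=\{k\in\mathbb{R}^2: p(s,k)\text{ is stable}\}$.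
   Context: A polynomial in $s$ is stable if all its roots lie in the open left half-plane $\{s\in\mathbb{C}:\mathrm{Re}\,s<0\}$. $\succ0$ means positive definite. Bézoutian: for two polynomials $a(u),b(u)$ in one indeterminate $u$, with $M$ the maximum of their degrees in $u$, $B_u(a,b)$ is the symmetric $M\times M$ matrix $(b_{ij})$ defined by $\frac{a(u)b(v)-a(v)b(u)}{v-u}=\sum_{i,j=1}^M b_{ij}u^{i-1}v^{j-1}$. Real and imaginary parts: with $j$ the imaginary unit, for $i=0,1,2$ the real polynomials $p_{iR},p_{iI}$ are defined by $p_{iR}(\omega^2)=\mathrm{Re}\,p_i(j\omega)$ and $\omega\,p_{iI}(\omega^2)=\mathrm{Im}\,p_i(j\omega)$ for real $\omega$. Put $p_R(\cdot,k)=p_{0R}+k_1p_{1R}+k_2p_{2R}$ and $p_I(\cdot,k)=p_{0I}+k_1p_{1I}+k_2p_{2I}$. Hermite matrix: $H(k)=B_\omega\big(p_R(\omega^2,k),\omega p_I(\omega^2,k)\big)$, an $n\times n$ symmetric matrix. Pencil: let $l(k)=p_R(0,k)=p_{0R}(0)+k_1p_{1R}(0)+k_2p_{2R}(0)$, and let $q_0=p_{1I}p_{2R}-p_{1R}p_{2I}$, $q_1=p_{2I}p_{0R}-p_{2R}p_{0I}$, $q_2=-p_{1I}p_{0R}+p_{1R}p_{0I}$, polynomials in one indeterminate $\omega$. Let $G(k)=B_\omega(q_1,q_2)+k_1B_\omega(q_2,q_0)-k_2B_\omega(q_1,q_0)$, all Bézoutians being formed with the common size $\max(\deg q_0,\deg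 q_1,\deg q_2)$. Let $C(k)=\mathrm{diag}\{l(k),G(k)\}$ (block diagonal). Curve: $\mathcal{C}=\{k\in\mathbb{R}^2:\det C(k)=0\}$. It partitions the plane into finitely many connected components, the $\mathcal{S}_i$. *)

theory Defs
  imports
    "HOL-Analysis.Connected"
    "HOL-Computational_Algebra.Polynomial_Factorial"
    "Jordan_Normal_Form.Determinant"
begin

definition stable_poly :: "real poly \<Rightarrow> bool" where
  "stable_poly p \<longleftrightarrow> (\<forall>s::complex. poly (map_poly of_real p) s = 0 \<longrightarrow> Re s < 0)"

definition pos_def_mat :: "real mat \<Rightarrow> bool" where
  "pos_def_mat A \<longleftrightarrow> square_mat A \<and> transpose_mat A = A \<and>
     (\<forall>v \<in> carrier_vec (dim_row A). v \<noteq> 0\<^sub>v (dim_row A) \<longrightarrow> scalar_prod v (A *\<^sub>v v) > 0)"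


subsection \<open>Bezoutians\<close>

text \<open>
  Bivariate polynomials are elements of \<open>real poly poly\<close>: the outer indeterminate is \<open>v\<close>, the
  inner one is \<open>u\<close>, so that \<open>coeff (coeff Q j) i\<close> is the coefficient of \<open>u ^ i * v ^ j\<close> in \<open>Q\<close>.
\<close>

definition in_u :: "real poly \<Rightarrow> real poly poly" where
  "in_u a = [:a:]"

definition in_v :: "real poly \<Rightarrow> real poly poly" where
  "in_v b = map_poly (\<lambda>c. [:c:]) b"

definition bezout_poly :: "real poly \<Rightarrow> real poly \<Rightarrow> real poly poly" where
  "bezout_poly a b =
     (in_u a * in_v b - in_v a * in_u b) div (in_v [:0, 1:] - in_u [:0, 1:])"

text \<open>Row and column indices start at 0. The size \<open>M\<close> may exceed both degrees.\<close>

definition bezoutian_of_size :: "nat \<Rightarrow> real poly \<Rightarrow> real poly \<Rightarrow> real mat" where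
  "bezoutian_of_size M a b = mat M M (\<lambda>(i, j). coeff (coeff (bezout_poly a b) j) i)"

definition bezoutian :: "real poly \<Rightarrow> real poly \<Rightarrow> real mat" where
  "bezoutian a b = bezoutian_of_size (max (degree a) (degree b)) a b"

text \<open>The division in the definition of \<^const>\<open>bezout_poly\<close> is exact.\<close>

lemma poly_in_v: "poly (in_v b) x = b \<circ>\<^sub>p x"
  unfolding in_v_def by (induction b) (auto simp: map_poly_pCons pcompose_pCons)

lemma bezout_poly_mult:
  "(in_v [:0, 1:] - in_u [:0, 1:]) * bezout_poly a b = in_u a * in_v b - in_v a * in_u b"
proof -
  have "in_v [:0, 1:] - in_u [:0, 1:] = [:- [:0, 1:], 1:]"
    by (simp add: in_v_def in_u_def map_poly_pCons)
  moreover have "poly (in_u a * in_v b - in_v a * in_u b) [:0, 1:] = 0"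
    by (simp add: poly_in_v in_u_def pcompose_idR)
  ultimately have "in_v [:0, 1:] - in_u [:0, 1:] dvd in_u a * in_v b - in_v a * in_u b"
    using poly_eq_0_iff_dvd by metis
  then show ?thesis
    unfolding bezout_poly_def by (rule dvd_mult_div_cancel)
qed

lemma bezout_poly_identity:
  fixes u v :: real
  shows "(v - u) * poly (poly (bezout_poly a b) [:v:]) u =
    poly a u * poly b v - poly a v * poly b u"
  using arg_cong[OF bezout_poly_mult[of a b], of "\<lambda>Q. poly (poly Q [:v:]) u"]
  by (simp add: poly_in_v in_u_def poly_pcompose)


subsection \<open>Real and imaginary parts on the imaginary axis\<close>

definition re_part :: "real poly \<Rightarrow> real poly" where
  "re_part p = (THE r. \<forall>\<omega>::real.
     poly r (\<omega>\<^sup>2) = Re (poly (map_poly of_real p) (\<i> * of_real \<omega>)))"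

definition im_part :: "real poly \<Rightarrow> real poly" where
  "im_part p = (THE r. \<forall>\<omega>::real.
     \<omega> * poly r (\<omega>\<^sup>2) = Im (poly (map_poly of_real p) (\<i> * of_real \<omega>)))"

lemma ex_re_im_part:
  "\<exists>r q. (\<forall>\<omega>::real. poly r (\<omega>\<^sup>2) = Re (poly (map_poly of_real p) (\<i> * of_real \<omega>))) \<and>
     (\<forall>\<omega>::real. \<omega> * poly q (\<omega>\<^sup>2) = Im (poly (map_poly of_real p) (\<i> * of_real \<omega>)))"
proof (induction p)
  case 0
  show ?case by (auto intro!: exI[of _ 0])
next
  case (pCons a p)
  then obtain r q where
    rq: "\<And>\<omega>::real. poly r (\<omega>\<^sup>2) = Re (poly (map_poly of_real p) (\<i> * of_real \<omega>))"
       "\<And>\<omega>::real. \<omega> * poly q (\<omega>\<^sup>2) = Im (poly (map_poly of_real p) (\<i> * of_real \<omega>))"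
    by blast
  show ?case
    using pCons.hyps
    by (intro exI[of _ "pCons a (- q)"] exI[of _ r] conjI allI)
      (simp_all add: map_poly_pCons rq[symmetric] power2_eq_square del: of_real_mult)
qed

lemma poly_eqI_pos:
  fixes r q :: "real poly"
  assumes "\<And>x. x > 0 \<Longrightarrow> poly r x = poly q x"
  shows "r = q"
proof -
  have "{0<..} \<subseteq> {x. poly (r - q) x = 0}"
    using assms by auto
  then have "infinite {x. poly (r - q) x = 0}"
    using infinite_Ioi finite_subset by blast
  then show ?thesis
    using poly_roots_finite[of "r - q"] by auto
qed

lemma poly_re_part:
  "poly (re_part p) (\<omega>\<^sup>2) = Re (poly (map_poly of_real p) (\<i> * of_real \<omega>))" for \<omega> :: real
proof -
  have "\<exists>!r. \<forall>\<omega>::real. poly r (\<omega>\<^sup>2) = Re (poly (map_poly of_real p) (\<i> * of_real \<omega>))"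
  proof (rule ex_ex1I)
    fix r q
    assume *: "\<forall>\<omega>::real. poly r (\<omega>\<^sup>2) = Re (poly (map_poly of_real p) (\<i> * of_real \<omega>))"
      "\<forall>\<omega>::real. poly q (\<omega>\<^sup>2) = Re (poly (map_poly of_real p) (\<i> * of_real \<omega>))"
    show "r = q"
    proof (rule poly_eqI_pos)
      fix x :: real assume "x > 0"
      then show "poly r x = poly q x"
        using *[rule_format, of "sqrt x"] by simp
    qed
  qed (use ex_re_im_part in blast)
  from theI'[OF this] show ?thesis
    unfolding re_part_def by blast
qed

lemma poly_im_part:
  "\<omega> * poly (im_part p) (\<omega>\<^sup>2) = Im (poly (map_poly of_real p) (\<i> * of_real \<omega>))" for \<omega> :: real
proof -
  have "\<exists>!r. \<forall>\<omega>::real. \<omega> * poly r (\<omega>\<^sup>2) = Im (poly (map_poly of_real p) (\<i> * of_real \<omega>))"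
  proof (rule ex_ex1I)
    fix r q
    assume *: "\<forall>\<omega>::real. \<omega> * poly r (\<omega>\<^sup>2) = Im (poly (map_poly of_real p) (\<i> * of_real \<omega>))"
      "\<forall>\<omega>::real. \<omega> * poly q (\<omega>\<^sup>2) = Im (poly (map_poly of_real p) (\<i> * of_real \<omega>))"
    show "r = q"
    proof (rule poly_eqI_pos)
      fix x :: real assume x: "x > 0"
      have "sqrt x * poly r ((sqrt x)\<^sup>2) = sqrt x * poly q ((sqrt x)\<^sup>2)"
        using * by metis
      then show "poly r x = poly q x"
        using x by simp
    qed
  qed (use ex_re_im_part in blast)
  from theI'[OF this] show ?thesis
    unfolding im_part_def by blast
qed


subsection \<open>Hermite matrix, pencil and curve of a two-parameter family\<close>

text \<open>A parameter vector \<open>k \<in> \<real>\<^sup>2\<close> is a pair \<open>(k1, k2)\<close>.\<close>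

definition poly_family :: "real poly \<Rightarrow> real poly \<Rightarrow> real poly \<Rightarrow> real \<times> real \<Rightarrow> real poly" where
  "poly_family p0 p1 p2 k = p0 + smult (fst k) p1 + smult (snd k) p2"

definition family_re :: "real poly \<Rightarrow> real poly \<Rightarrow> real poly \<Rightarrow> real \<times> real \<Rightarrow> real poly" where
  "family_re p0 p1 p2 k = poly_family (re_part p0) (re_part p1) (re_part p2) k"

definition family_im :: "real poly \<Rightarrow> real poly \<Rightarrow> real poly \<Rightarrow> real \<times> real \<Rightarrow> real poly" where
  "family_im p0 p1 p2 k = poly_family (im_part p0) (im_part p1) (im_part p2) k"

definition hermite_mat :: "real poly \<Rightarrow> real poly \<Rightarrow> real poly \<Rightarrow> real \<times> real \<Rightarrow> real mat" where
  "hermite_mat p0 p1 p2 k =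
     bezoutian (family_re p0 p1 p2 k \<circ>\<^sub>p [:0, 1:]\<^sup>2)
               ([:0, 1:] * (family_im p0 p1 p2 k \<circ>\<^sub>p [:0, 1:]\<^sup>2))"

definition pencil_l :: "real poly \<Rightarrow> real poly \<Rightarrow> real poly \<Rightarrow> real \<times> real \<Rightarrow> real" where
  "pencil_l p0 p1 p2 k = poly (family_re p0 p1 p2 k) 0"

definition pencil_q0 :: "real poly \<Rightarrow> real poly \<Rightarrow> real poly \<Rightarrow> real poly" where
  "pencil_q0 p0 p1 p2 = im_part p1 * re_part p2 - re_part p1 * im_part p2"

definition pencil_q1 :: "real poly \<Rightarrow> real poly \<Rightarrow> real poly \<Rightarrow> real poly" where
  "pencil_q1 p0 p1 p2 = im_part p2 * re_part p0 - re_part p2 * im_part p0"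

definition pencil_q2 :: "real poly \<Rightarrow> real poly \<Rightarrow> real poly \<Rightarrow> real poly" where
  "pencil_q2 p0 p1 p2 = - im_part p1 * re_part p0 + re_part p1 * im_part p0"

definition pencil_G :: "real poly \<Rightarrow> real poly \<Rightarrow> real poly \<Rightarrow> real \<times> real \<Rightarrow> real mat" where
  "pencil_G p0 p1 p2 k =
     (let r0 = pencil_q0 p0 p1 p2; r1 = pencil_q1 p0 p1 p2; r2 = pencil_q2 p0 p1 p2;
          M = max (degree r0) (max (degree r1) (degree r2))
      in bezoutian_of_size M r1 r2 + fst k \<cdot>\<^sub>m bezoutian_of_size M r2 r0
           - snd k \<cdot>\<^sub>m bezoutian_of_size M r1 r0)"

text \<open>If all three \<open>q\<close>-polynomials are constant, the block \<^const>\<open>pencil_G\<close> is empty.\<close>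

definition pencil :: "real poly \<Rightarrow> real poly \<Rightarrow> real poly \<Rightarrow> real \<times> real \<Rightarrow> real mat" where
  "pencil p0 p1 p2 k = diag_block_mat [mat 1 1 (\<lambda>_. pencil_l p0 p1 p2 k), pencil_G p0 p1 p2 k]"

definition pencil_curve :: "real poly \<Rightarrow> real poly \<Rightarrow> real poly \<Rightarrow> (real \<times> real) set" where
  "pencil_curve p0 p1 p2 = {k. det (pencil p0 p1 p2 k) = 0}"

definition LMI_set :: "real poly \<Rightarrow> real poly \<Rightarrow> real poly \<Rightarrow> (real \<times> real) set" where
  "LMI_set p0 p1 p2 = {k. pos_def_mat (pencil p0 p1 p2 k)}"

definition stability_region :: "real poly \<Rightarrow> real poly \<Rightarrow> real poly \<Rightarrow> (real \<times> real) set" where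
  "stability_region p0 p1 p2 = {k. stable_poly (poly_family p0 p1 p2 k)}"

end

theory Submission
  imports
    Defs
    "HOL-Computational_Algebra.Field_as_Ring"
    "HOL-Computational_Algebra.Fundamental_Theorem_Algebra"
    "HOL-Analysis.Convex_Euclidean_Space"
    "Jordan_Normal_Form.Char_Poly"
begin

text \<open>
  The proof separates a statement on matrix pencils from a statement on roots.

  On the matrix side, \<open>C(k)\<close> is symmetric and affine in \<open>k\<close>. Its positive definite locus is therefore
  convex, it is open, and it is closed relative to the complement of the curve \<open>det C(k) = 0\<close>, because a
  positive semidefinite matrix with nonzero determinant is positive definite. So the component \<open>S\<close>, which meets
  the locus in \<open>k\<close>, is equal to it (\<open>affine_pencil_component\<close>).

  On the root side, positive definiteness of the Hermite matrix at the single parameter \<open>k\<close> makes \<open>p(s, k)\<close>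
  stable (\<open>hermite_criterion\<close>). When the parameter moves inside \<open>S\<close>, roots move continuously and
  none escapes to infinity, since the family is monic of fixed degree. Stability can thus be lost only through a
  root on the imaginary axis (\<open>stability_spreads\<close>). Such a root \<open>\<i> \<omega>\<close> makes \<open>C(k)\<close> singular: either
  \<open>\<omega> = 0\<close> and \<open>l(k) = 0\<close>, or \<open>\<omega>\<^sup>2\<close> is a common root of \<open>q\<^sub>1 - k\<^sub>1 q\<^sub>0\<close> and \<open>q\<^sub>2 - k\<^sub>2 q\<^sub>0\<close>, whose
  Bezoutian is \<open>G(k)\<close> (\<open>pencil_pos_def_no_imaginary_root\<close>).

  The second alternative yields a contradiction only if the block \<open>G\<close> has positive size. It has, but
  not for formal reasons: for \<open>p\<^sub>0, p\<^sub>1, p\<^sub>2\<close> all even, the \<open>q\<^sub>i\<close> vanish and \<open>G\<close> is empty. Existence of a stable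
  member of the family excludes this (\<open>pencil_size_pos\<close>).
\<close>

section \<open>Coefficients of Bezoutians\<close>

abbreviation bezout_coeff :: "real poly \<Rightarrow> real poly \<Rightarrow> nat \<Rightarrow> nat \<Rightarrow> real" where
  "bezout_coeff a b i j \<equiv> coeff (coeff (bezout_poly a b) j) i"

lemma coeff_in_v: "coeff (in_v b) j = [:coeff b j:]"
  by (simp add: in_v_def coeff_map_poly)

text \<open>
  Comparing the coefficients of \<open>u ^ i * v ^ j\<close> on both sides of the defining identity gives a
  recursion along the antidiagonals \<open>i + j = const\<close>. Symmetry, vanishing outside the \<open>M \<times> M\<close> block and
  bilinearity of the entries follow from it by induction on the row index.
\<close>

lemma bezout_coeff_rec:
  "(case j of 0 \<Rightarrow> 0 | Suc j' \<Rightarrow> bezout_coeff a b i j') -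
     (case i of 0 \<Rightarrow> 0 | Suc i' \<Rightarrow> bezout_coeff a b i' j) =
   coeff a i * coeff b j - coeff a j * coeff b i"
proof -
  have "in_v [:0, 1:] - in_u [:0, 1:] = [:- [:0, 1:], 1:]"
    by (simp add: in_v_def in_u_def map_poly_pCons)
  then have "coeff (coeff ([:- [:0, 1:], 1:] * bezout_poly a b) j) i =
      coeff (coeff (in_u a * in_v b - in_v a * in_u b) j) i"
    using bezout_poly_mult[of a b] by simp
  then show ?thesis
    by (simp add: in_u_def coeff_in_v coeff_pCons mult.commute[of _ "[:_:]"] split: nat.splits)
qed

lemma bezout_coeff_0: "bezout_coeff a b 0 j = coeff a 0 * coeff b (Suc j) - coeff a (Suc j) * coeff b 0"
  using bezout_coeff_rec[where i = 0 and j = "Suc j" and a = a and b = b] by simp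

lemma bezout_coeff_Suc:
  "bezout_coeff a b (Suc i) j = bezout_coeff a b i (Suc j) +
     (coeff a (Suc i) * coeff b (Suc j) - coeff a (Suc j) * coeff b (Suc i))"
  using bezout_coeff_rec[where i = "Suc i" and j = "Suc j" and a = a and b = b] by simp

text \<open>
  The right-hand side of the recursion is antisymmetric in \<open>(i, j)\<close>, so the skew part \<open>D\<close> of the
  coefficient array is constant along antidiagonals; being skew, it vanishes.
\<close>

lemma bezout_coeff_sym: "bezout_coeff a b i j = bezout_coeff a b j i"
proof -
  define D where "D i j = bezout_coeff a b i j - bezout_coeff a b j i" for i j
  have step: "D (Suc i) j = D i (Suc j)" for i j
    by (simp add: D_def bezout_coeff_Suc[of a b i j] bezout_coeff_Suc[of a b j i])
  have "D i j = D 0 (i + j)" for i j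
    by (induction i arbitrary: j) (simp_all add: step)
  then have "D i j = D j i"
    by (metis add.commute)
  then show ?thesis
    by (simp add: D_def)
qed

lemma bezout_coeff_eq_0:
  assumes "degree a \<le> M" "degree b \<le> M" "M \<le> j"
  shows "bezout_coeff a b i j = 0"
  using assms(3)
proof (induction i arbitrary: j)
  case 0
  then show ?case
    using assms by (simp add: bezout_coeff_0 coeff_eq_0)
next
  case (Suc i)
  then show ?case
    using assms by (simp add: bezout_coeff_Suc coeff_eq_0)
qed

text \<open>
  This identity makes the pencil block \<open>G(k)\<close> a single Bezoutian: it is the Bezoutian of
  \<open>q\<^sub>1 - k\<^sub>1 q\<^sub>0\<close> and \<open>q\<^sub>2 - k\<^sub>2 q\<^sub>0\<close>. The product term \<open>k\<^sub>1 k\<^sub>2\<close> drops out because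
  the Bezoutian of \<open>q\<^sub>0\<close> with itself is zero, which is why \<open>G\<close> is affine in \<open>k\<close>.
\<close>

lemma bezout_coeff_combination:
  "bezout_coeff (a1 - smult s a0) (a2 - smult t a0) i j =
    bezout_coeff a1 a2 i j + s * bezout_coeff a2 a0 i j - t * bezout_coeff a1 a0 i j"
proof (induction i arbitrary: j)
  case 0
  show ?case by (simp add: bezout_coeff_0 algebra_simps)
next
  case (Suc i)
  show ?case by (simp add: bezout_coeff_Suc Suc.IH algebra_simps)
qed

section \<open>Bezoutians at complex arguments\<close>

interpretation of_real_poly_hom: map_poly_inj_idom_hom "of_real :: real \<Rightarrow> complex" ..

abbreviation cpoly :: "real poly \<Rightarrow> complex \<Rightarrow> complex" where
  "cpoly p \<equiv> poly (map_poly of_real p)"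

lemma cpoly_simps:
  "cpoly (p + q) z = cpoly p z + cpoly q z"
  "cpoly (p - q) z = cpoly p z - cpoly q z"
  "cpoly (p * q) z = cpoly p z * cpoly q z"
  "cpoly (smult c p) z = of_real c * cpoly p z"
  by (simp_all add: hom_distribs)

lemma cpoly_pCons: "cpoly (pCons c p) z = of_real c + z * cpoly p z"
  by (simp add: of_real_hom.map_poly_pCons_hom)

lemma cpoly_of_real: "cpoly p (of_real x) = of_real (poly p x)"
  by simp

lemma cpoly_cnj: "cpoly p (cnj z) = cnj (cpoly p z)"
  by (induction p) simp_all

lemma cpoly_pcompose: "cpoly (p \<circ>\<^sub>p q) z = cpoly p (cpoly q z)"
  by (induction p) (simp_all add: pcompose_pCons cpoly_simps cpoly_pCons)

text \<open>
  The Hermite criterion evaluates the Bezoutian at a complex root and its conjugate, so the defining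
  identity is needed at complex arguments. Substituting \<open>u\<close> into the inner polynomials is a ring
  homomorphism, which transports the identity of bivariate polynomials.
\<close>

lemma bezout_sum_identity:
  fixes u v :: complex
  assumes "degree a \<le> M" "degree b \<le> M"
  shows "(v - u) * (\<Sum>i<M. \<Sum>j<M. of_real (bezout_coeff a b i j) * u ^ i * v ^ j) =
    cpoly a u * cpoly b v - cpoly a v * cpoly b u"
proof -
  define h where "h = (\<lambda>c. cpoly c u)"
  interpret h: comm_ring_hom h
    by unfold_locales (simp_all add: h_def cpoly_simps)
  interpret mh: map_poly_comm_ring_hom h ..
  let ?Q = "bezout_poly a b"
  have in_u: "poly (map_poly h (in_u c)) v = cpoly c u" for c
    by (simp add: in_u_def h.map_poly_pCons_hom, simp add: h_def)
  have in_v: "poly (map_poly h (in_v c)) v = cpoly c v" for c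
  proof -
    have "map_poly h (in_v c) = map_poly of_real c"
      by (rule poly_eqI) (simp add: coeff_in_v coeff_map_poly h_def cpoly_pCons)
    then show ?thesis by simp
  qed
  have "(v - u) * poly (map_poly h ?Q) v = cpoly a u * cpoly b v - cpoly a v * cpoly b u"
    using arg_cong[OF bezout_poly_mult[of a b], of "\<lambda>Q. poly (map_poly h Q) v"]
    by (simp add: in_u in_v hom_distribs cpoly_pCons)
  moreover have "poly (map_poly h ?Q) v =
      (\<Sum>i<M. \<Sum>j<M. of_real (bezout_coeff a b i j) * u ^ i * v ^ j)"
  proof -
    have expand: "poly p x = (\<Sum>i<M. coeff p i * x ^ i)"
      if "\<And>i. i \<ge> M \<Longrightarrow> coeff p i = 0" for p :: "complex poly" and x
    proof -
      have "poly p x = (\<Sum>i\<le>degree p. coeff p i * x ^ i)" by (rule poly_altdef)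
      also have "\<dots> = (\<Sum>i<M. coeff p i * x ^ i)"
        by (intro sum.mono_neutral_cong) (auto simp: coeff_eq_0 that)
      finally show ?thesis .
    qed
    have 1: "h (coeff ?Q j) = (\<Sum>i<M. of_real (bezout_coeff a b i j) * u ^ i)" for j
      unfolding h_def
      by (subst expand) (use bezout_coeff_eq_0[OF assms] bezout_coeff_sym in
          \<open>auto simp: coeff_map_poly\<close>)
    have "poly (map_poly h ?Q) v = (\<Sum>j<M. h (coeff ?Q j) * v ^ j)"
      by (subst expand) (use bezout_coeff_eq_0[OF assms] in \<open>auto simp: 1\<close>)
    also have "\<dots> = (\<Sum>j<M. \<Sum>i<M. of_real (bezout_coeff a b i j) * u ^ i * v ^ j)"
      by (simp add: 1 sum_distrib_right)
    also have "\<dots> = (\<Sum>i<M. \<Sum>j<M. of_real (bezout_coeff a b i j) * u ^ i * v ^ j)"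
      by (rule sum.swap)
    finally show ?thesis .
  qed
  ultimately show ?thesis by simp
qed

section \<open>Even and odd parts\<close>

lemma re_part_unique:
  assumes "\<And>\<omega>::real. poly r (\<omega>\<^sup>2) = Re (cpoly p (\<i> * of_real \<omega>))"
  shows "re_part p = r"
proof (rule poly_eqI_pos)
  fix x :: real assume "x > 0"
  then show "poly (re_part p) x = poly r x"
    using assms[of "sqrt x"] poly_re_part[of p "sqrt x"] by simp
qed

lemma im_part_unique:
  assumes "\<And>\<omega>::real. \<omega> * poly r (\<omega>\<^sup>2) = Im (cpoly p (\<i> * of_real \<omega>))"
  shows "im_part p = r"
proof (rule poly_eqI_pos)
  fix x :: real assume "x > 0"
  then show "poly (im_part p) x = poly r x"
    using assms[of "sqrt x"] poly_im_part[of "sqrt x" p] mult_left_cancel[of "sqrt x"]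
    by (metis less_imp_le real_sqrt_gt_0_iff order_less_irrefl real_sqrt_pow2)
qed

lemma re_im_part_linear:
  "re_part (p + q) = re_part p + re_part q" "re_part (smult c p) = smult c (re_part p)"
  "im_part (p + q) = im_part p + im_part q" "im_part (smult c p) = smult c (im_part p)"
  by (rule re_part_unique im_part_unique,
      simp add: cpoly_simps poly_re_part distrib_left mult.left_commute poly_im_part)+

lemma re_im_part_family:
  "re_part (poly_family p0 p1 p2 k) = family_re p0 p1 p2 k"
  "im_part (poly_family p0 p1 p2 k) = family_im p0 p1 p2 k"
  by (simp_all add: family_re_def family_im_def poly_family_def re_im_part_linear)

lemma re_im_part_0: "re_part 0 = 0" "im_part 0 = 0"
  by (rule re_part_unique, simp) (rule im_part_unique, simp)

lemma re_im_part_pCons: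
  "re_part (pCons c p) = pCons c (- im_part p)" "im_part (pCons c p) = re_part p"
  by (rule re_part_unique, simp add: cpoly_pCons flip: poly_im_part, simp add: power2_eq_square)
    (rule im_part_unique, simp add: cpoly_pCons flip: poly_re_part)

text \<open>
  With \<open>s = \<i> \<omega>\<close>, \<open>\<omega>\<^sup>2 = - s\<^sup>2\<close>, so \<open>re_part\<close> and \<open>im_part\<close> are the even and the odd half of the polynomial
  in the variable \<open>- s\<^sup>2\<close>. In particular a polynomial is determined by the two halves.
\<close>

lemma even_odd_decomposition:
  "p = re_part p \<circ>\<^sub>p [:0, 0, -1:] + [:0, 1:] * (im_part p \<circ>\<^sub>p [:0, 0, -1:])"
proof (induction p)
  case 0
  show ?case by (simp add: re_im_part_0)
next
  case (pCons c p)
  define X J :: "real poly" where "X = [:0, 1:]" and "J = [:0, 0, -1:]"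
  define R I where "R = re_part p \<circ>\<^sub>p J" and "I = im_part p \<circ>\<^sub>p J"
  have J: "J = - (X * X)"
    by (simp add: X_def J_def)
  have "pCons c p = [:c:] + X * p"
    by (simp add: X_def)
  also have "\<dots> = [:c:] + X * (R + X * I)"
    using pCons.IH by (simp add: R_def I_def X_def J_def)
  also have "[:c:] + X * (R + X * I) = ([:c:] + J * (- I)) + X * R"
    unfolding J by (simp only: algebra_simps)
  finally show ?case
    unfolding X_def[symmetric] J_def[symmetric] re_im_part_pCons pcompose_pCons pcompose_uminus
      R_def I_def .
qed

lemma reflected_even_odd_decomposition:
  "p \<circ>\<^sub>p [:0, -1:] = re_part p \<circ>\<^sub>p [:0, 0, -1:] - [:0, 1:] * (im_part p \<circ>\<^sub>p [:0, 0, -1:])"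
proof -
  have J: "[:0, 0, -1::real:] \<circ>\<^sub>p [:0, -1:] = [:0, 0, -1:]"
    by (simp add: pcompose_pCons)
  have "p \<circ>\<^sub>p [:0, -1:] = (re_part p \<circ>\<^sub>p [:0, 0, -1:] +
      [:0, 1:] * (im_part p \<circ>\<^sub>p [:0, 0, -1:])) \<circ>\<^sub>p [:0, -1:]"
    using even_odd_decomposition[of p] by simp
  also have "\<dots> = re_part p \<circ>\<^sub>p ([:0, 0, -1:] \<circ>\<^sub>p [:0, -1:]) +
      ([:0, 1:] \<circ>\<^sub>p [:0, -1:]) * (im_part p \<circ>\<^sub>p ([:0, 0, -1:] \<circ>\<^sub>p [:0, -1:]))"
    by (simp only: pcompose_add pcompose_mult pcompose_assoc)
  also have "\<dots> = re_part p \<circ>\<^sub>p [:0, 0, -1:] +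
      (- [:0, 1:]) * (im_part p \<circ>\<^sub>p [:0, 0, -1:])"
    unfolding J by (simp add: pcompose_pCons)
  finally show ?thesis
    by (simp only: mult_minus_left diff_conv_add_uminus)
qed

lemma cpoly_imaginary:
  "cpoly p (\<i> * w) = cpoly (re_part p) (w\<^sup>2) + \<i> * w * cpoly (im_part p) (w\<^sup>2)"
proof -
  have "cpoly [:0, 0, -1:] (\<i> * w) = w\<^sup>2" "cpoly [:0, 1:] (\<i> * w) = \<i> * w"
    by (simp_all add: cpoly_pCons power2_eq_square algebra_simps)
  then show ?thesis
    by (subst even_odd_decomposition[of p]) (simp only: cpoly_simps cpoly_pcompose)
qed

section \<open>Positive definite Bezoutians and the Hermite criterion\<close>

text \<open>
  Vectors are functions on all naturals of which only the first \<open>d\<close> values count; this lets power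
  sequences \<open>i \<mapsto> x ^ i\<close> be inserted for every size without change of type.
\<close>

definition bilin :: "nat \<Rightarrow> (nat \<Rightarrow> nat \<Rightarrow> real) \<Rightarrow> (nat \<Rightarrow> real) \<Rightarrow> (nat \<Rightarrow> real) \<Rightarrow> real" where
  "bilin d h x y = (\<Sum>i<d. \<Sum>j<d. h i j * x i * y j)"

lemma bilin_eq_scalar_prod:
  assumes "A \<in> carrier_mat d d"
  shows "bilin d (\<lambda>i j. A $$ (i, j)) x y = scalar_prod (Matrix.vec d x) (A *\<^sub>v Matrix.vec d y)"
  using assms by (simp add: bilin_def scalar_prod_def sum_distrib_left lessThan_atLeast0 mult_ac)

lemma vec_eq_0_iff: "Matrix.vec d x = 0\<^sub>v d \<longleftrightarrow> (\<forall>i<d. x i = 0)"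
  by auto (metis index_vec index_zero_vec(1))

lemma pos_def_mat_iff:
  assumes A: "A \<in> carrier_mat d d"
  shows "pos_def_mat A \<longleftrightarrow> transpose_mat A = A \<and>
    (\<forall>x. (\<exists>i<d. x i \<noteq> 0) \<longrightarrow> 0 < bilin d (\<lambda>i j. A $$ (i, j)) x x)"
proof -
  have "(\<forall>v\<in>carrier_vec d. v \<noteq> 0\<^sub>v d \<longrightarrow> 0 < scalar_prod v (A *\<^sub>v v)) \<longleftrightarrow>
      (\<forall>x. Matrix.vec d x \<noteq> 0\<^sub>v d \<longrightarrow> 0 < scalar_prod (Matrix.vec d x) (A *\<^sub>v Matrix.vec d x))"
    (is "(\<forall>v\<in>_. ?P v) \<longleftrightarrow> (\<forall>x. ?P (Matrix.vec d x))")
  proof safe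
    fix v :: "real Matrix.vec" assume "\<forall>x. ?P (Matrix.vec d x)" "v \<in> carrier_vec d" "v \<noteq> 0\<^sub>v d"
    moreover from this have "v = Matrix.vec d (\<lambda>i. v $ i)" by auto
    ultimately show "0 < scalar_prod v (A *\<^sub>v v)" by metis
  qed simp
  then show ?thesis
    using A unfolding pos_def_mat_def bilin_eq_scalar_prod[OF A] by (auto simp: vec_eq_0_iff)
qed

lemma pos_def_bilin_pos:
  assumes "pos_def_mat A" "A \<in> carrier_mat d d" "i < d" "x i \<noteq> 0"
  shows "0 < bilin d (\<lambda>i j. A $$ (i, j)) x x"
  using assms pos_def_mat_iff by blast

lemma pos_def_bilin_nonneg:
  assumes "pos_def_mat A" "A \<in> carrier_mat d d"
  shows "0 \<le> bilin d (\<lambda>i j. A $$ (i, j)) x x"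
proof (cases "\<exists>i<d. x i \<noteq> 0")
  case True
  then show ?thesis using pos_def_bilin_pos[OF assms] by (blast intro: less_imp_le)
qed (simp add: bilin_def)

text \<open>
  At a common root \<open>r\<close> the generating polynomial of the Bezoutian satisfies
  \<open>(r - u) B(u, r) = 0\<close> for all \<open>u\<close>. Hence \<open>B(r, r) = 0\<close>, and this is the value of the quadratic form
  on the nonzero vector \<open>(1, r, r\<^sup>2, \<dots>)\<close>.
\<close>

lemma pos_def_bezoutian_no_common_real_root:
  assumes deg: "degree a \<le> M" "degree b \<le> M"
    and pos: "\<And>x. x 0 \<noteq> 0 \<Longrightarrow> 0 < bilin M (bezout_coeff a b) x x"
  shows "poly a r \<noteq> 0 \<or> poly b r \<noteq> 0"
proof (rule ccontr)
  assume "\<not> ?thesis"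
  then have root: "poly a r = 0" "poly b r = 0" by auto
  \<comment> \<open>The sum over \<open>j\<close> is evaluated at the root; \<open>P\<close> keeps the other variable \<open>u\<close> free.\<close>
  define P where "P = (\<Sum>i<M. monom (\<Sum>j<M. complex_of_real (bezout_coeff a b i j) * of_real r ^ j) i)"
  have P: "poly P u = (\<Sum>i<M. \<Sum>j<M. of_real (bezout_coeff a b i j) * u ^ i * of_real r ^ j)" for u
    by (simp add: P_def poly_sum poly_monom sum_distrib_left sum_distrib_right mult_ac)
  have "poly ([:of_real r, -1:] * P) u = 0" for u
    using bezout_sum_identity[OF deg, of "of_real r" u] root by (auto simp: P)
  then have "[:of_real r, -1:] * P = 0"
    using poly_all_0_iff_0 by blast
  then have "P = 0"
    unfolding mult_eq_0_iff by simp
  then have "complex_of_real (\<Sum>i<M. \<Sum>j<M. bezout_coeff a b i j * r ^ i * r ^ j) = 0"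
    using P[of "of_real r"] by simp
  then show False
    using pos[of "\<lambda>i. r ^ i"] by (simp only: of_real_eq_0_iff power_0 bilin_def) simp
qed

text \<open>
  Write \<open>p(\<i> w) = a(w) + \<i> b(w)\<close>. At a root \<open>s = \<i> w\<close> we have \<open>a(w) = - \<i> b(w)\<close>, and the Bezout identity
  at \<open>(cnj w, w)\<close> becomes \<open>Im w * T = \<bar>b(w)\<bar>\<^sup>2\<close>, where \<open>T\<close> is the Hermitian form of the Bezoutian on
  \<open>(1, w, w\<^sup>2, \<dots>)\<close>. Positivity of \<open>T\<close> forces \<open>Im w \<ge> 0\<close>, and \<open>Im w = 0\<close> would make \<open>w\<close> a common real
  root of \<open>a\<close> and \<open>b\<close>. So \<open>Re s = - Im w < 0\<close>.
\<close>

lemma hermite_criterion: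
  assumes deg: "degree p > 0"
    and a: "a = re_part p \<circ>\<^sub>p [:0, 1:]\<^sup>2" and b: "b = [:0, 1:] * (im_part p \<circ>\<^sub>p [:0, 1:]\<^sup>2)"
    and pd: "pos_def_mat (bezoutian a b)"
  shows "stable_poly p"
  unfolding stable_poly_def
proof (intro allI impI)
  fix s assume s: "cpoly p s = 0"
  define w where "w = - \<i> * s"
  have s_w: "s = \<i> * w" by (simp add: w_def)
  have cX2: "cpoly ([:0, 1:]\<^sup>2) z = z\<^sup>2" for z
    by (simp add: power2_eq_square cpoly_pCons)
  have ab: "cpoly p (\<i> * z) = cpoly a z + \<i> * cpoly b z" for z
    unfolding cpoly_imaginary a b cpoly_simps cpoly_pcompose cX2 by (simp add: cpoly_pCons)
  define M where "M = max (degree a) (degree b)"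
  have degs: "degree a \<le> M" "degree b \<le> M" by (simp_all add: M_def)
  \<comment> \<open>If \<open>M = 0\<close>, then \<open>p(\<i> w)\<close> does not depend on \<open>w\<close>, but \<open>p\<close> is not constant.\<close>
  have "M \<noteq> 0"
  proof
    assume "M = 0"
    then obtain \<alpha> \<beta> where "a = [:\<alpha>:]" "b = [:\<beta>:]"
      using degs by (metis degree_eq_zeroE le_zero_eq)
    then have const: "cpoly p (\<i> * z) = of_real \<alpha> + \<i> * of_real \<beta>" for z
      using ab by (simp add: cpoly_pCons)
    then have "cpoly p z = 0" for z
      using const[of w] const[of "- \<i> * z"] s s_w by simp
    then have "map_poly complex_of_real p = 0"
      using poly_all_0_iff_0 by blast
    with deg show False by simp
  qed
  have pd_M: "pos_def_mat (bezoutian_of_size M a b)"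
    using pd by (simp add: bezoutian_def M_def)
  have carrier: "bezoutian_of_size M a b \<in> carrier_mat M M"
    by (simp add: bezoutian_of_size_def)
  define h where "h = bezout_coeff a b"
  have pos: "0 < bilin M h x x" if "x 0 \<noteq> 0" for x
    using pos_def_bilin_pos[OF pd_M carrier, of 0 x] that \<open>M \<noteq> 0\<close>
    by (simp add: bezoutian_of_size_def h_def bilin_def)
  have nonneg: "0 \<le> bilin M h x x" for x
    using pos_def_bilin_nonneg[OF pd_M carrier, of x]
    by (simp add: bezoutian_of_size_def h_def bilin_def)
  define T where "T = (\<Sum>i<M. \<Sum>j<M. of_real (h i j) * cnj w ^ i * w ^ j)"
  \<comment> \<open>As \<open>Re (cnj x * y) = Re x * Re y + Im x * Im y\<close>, the real part of \<open>T\<close> splits into two values of the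
    real quadratic form; the first is positive because \<open>Re (w ^ 0) = 1\<close>.\<close>
  have "Re T = (\<Sum>i<M. \<Sum>j<M. h i j * Re (w ^ i) * Re (w ^ j)) +
      (\<Sum>i<M. \<Sum>j<M. h i j * Im (w ^ i) * Im (w ^ j))"
    unfolding T_def sum.distrib[symmetric] Re_sum complex_cnj_power[symmetric]
    by (intro sum.cong refl) (simp add: algebra_simps del: complex_cnj_power)
  then have Re_T: "Re T > 0"
    using pos[of "\<lambda>i. Re (w ^ i)"] nonneg[of "\<lambda>i. Im (w ^ i)"] by (simp add: bilin_def)
  have aw: "cpoly a w = - \<i> * cpoly b w"
    using ab[of w] s s_w by (simp add: add_eq_0_iff)
  have "(w - cnj w) * T = cnj (cpoly a w) * cpoly b w - cpoly a w * cnj (cpoly b w)"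
    using bezout_sum_identity[OF degs, of w "cnj w"] by (simp add: T_def h_def cpoly_cnj)
  also have "\<dots> = 2 * \<i> * of_real ((cmod (cpoly b w))\<^sup>2)"
    unfolding aw complex_norm_square by (simp add: algebra_simps)
  finally have "\<i> * (2 * of_real (Im w) * T) = \<i> * (2 * of_real ((cmod (cpoly b w))\<^sup>2))"
    by (simp add: complex_diff_cnj algebra_simps)
  then have "of_real (Im w) * T = of_real ((cmod (cpoly b w))\<^sup>2)"
    by simp
  then have "Im w * Re T = (cmod (cpoly b w))\<^sup>2"
    by (auto simp: complex_eq_iff simp del: of_real_power)
  moreover have "Im w \<noteq> 0"
  proof
    assume Im: "Im w = 0"
    then have "cpoly b w = 0" using calculation by simp
    moreover from this have "cpoly a w = 0" using aw by simp
    moreover have "w = of_real (Re w)" using Im by (simp add: complex_eq_iff)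
    ultimately have "poly a (Re w) = 0" "poly b (Re w) = 0"
      by (metis cpoly_of_real of_real_eq_0_iff)+
    then show False
      using pos_def_bezoutian_no_common_real_root[OF degs] pos unfolding h_def by blast
  qed
  ultimately have "Im w > 0"
    using Re_T by (metis zero_le_mult_iff zero_le_power2 less_le not_less)
  then show "Re s < 0"
    by (simp add: s_w)
qed

section \<open>Positive definiteness along affine pencils\<close>

lemma bilin_line:
  assumes sym: "\<And>i j. i < d \<Longrightarrow> j < d \<Longrightarrow> h i j = h j i"
  shows "bilin d h (\<lambda>i. x i + t * y i) (\<lambda>i. x i + t * y i) =
    bilin d h x x + 2 * t * bilin d h x y + t\<^sup>2 * bilin d h y y"
proof -
  have "bilin d h y x = bilin d h x y"
    unfolding bilin_def by (subst sum.swap, intro sum.cong refl) (simp add: sym)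
  moreover have "bilin d h (\<lambda>i. x i + t * y i) (\<lambda>i. x i + t * y i) =
      bilin d h x x + t * bilin d h x y + t * bilin d h y x + t\<^sup>2 * bilin d h y y"
    unfolding bilin_def sum_distrib_left sum.distrib[symmetric]
    by (intro sum.cong refl) (simp add: algebra_simps power2_eq_square)
  ultimately show ?thesis by simp
qed

lemma nonneg_quadratic_discriminant:
  fixes a b c :: real
  assumes "0 \<le> a" and nonneg: "\<And>t. 0 \<le> c + 2 * t * b + t\<^sup>2 * a"
  shows "b\<^sup>2 \<le> c * a"
proof (cases "a = 0")
  case True
  have "b = 0"
  proof (rule ccontr)
    assume "b \<noteq> 0"
    \<comment> \<open>For \<open>a = 0\<close> the expression is linear in \<open>t\<close> and equals \<open>-1\<close> at this point.\<close>
    then show False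
      using nonneg[of "- (c + 1) / (2 * b)"] True by (simp add: field_simps)
  qed
  then show ?thesis using True by simp
next
  case False
  have "0 \<le> c + 2 * (- b / a) * b + (- b / a)\<^sup>2 * a"
    by (rule nonneg)
  also have "\<dots> = c - b\<^sup>2 / a"
    using False by (simp add: power2_eq_square)
  finally show ?thesis
    using False \<open>0 \<le> a\<close> by (simp add: divide_le_eq)
qed

text \<open>
  The Cauchy-Schwarz inequality needs semidefiniteness only; in the degenerate case it says that
  isotropic vectors lie in the kernel.
\<close>

lemma psd_cauchy_schwarz:
  assumes "\<And>i j. i < d \<Longrightarrow> j < d \<Longrightarrow> h i j = h j i" "\<And>x. 0 \<le> bilin d h x x"
  shows "(bilin d h x y)\<^sup>2 \<le> bilin d h x x * bilin d h y y"
proof (rule nonneg_quadratic_discriminant)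
  show "0 \<le> bilin d h x x + 2 * t * bilin d h x y + t\<^sup>2 * bilin d h y y" for t
    using assms(2) bilin_line[of d h x t y, OF assms(1)] by metis
qed (rule assms(2))

lemma symmetric_entry:
  assumes "A \<in> carrier_mat d d" "transpose_mat A = A" "i < d" "j < d"
  shows "A $$ (i, j) = A $$ (j, i)"
  using assms by (metis carrier_matD index_transpose_mat(1))

text \<open>
  Semidefiniteness is a closed condition, so this equivalence shows that positive definiteness can be
  lost along a continuous family only where the determinant vanishes.
\<close>

lemma pos_def_mat_iff_psd_det:
  assumes A: "A \<in> carrier_mat d d" and sym: "transpose_mat A = A"
  shows "pos_def_mat A \<longleftrightarrow> (\<forall>x. 0 \<le> bilin d (\<lambda>i j. A $$ (i, j)) x x) \<and> det A \<noteq> 0"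
    (is "?L \<longleftrightarrow> _")
proof safe
  let ?B = "bilin d (\<lambda>i j. A $$ (i, j))"
  fix x assume ?L
  then show "0 \<le> ?B x x" using pos_def_bilin_nonneg A by blast
next
  assume L: ?L and "det A = 0"
  then obtain v where v: "v \<in> carrier_vec d" "v \<noteq> 0\<^sub>v d" "A *\<^sub>v v = 0\<^sub>v d"
    using det_0_iff_vec_prod_zero[OF A] by blast
  then show False
    using L A unfolding pos_def_mat_def by fastforce
next
  let ?B = "bilin d (\<lambda>i j. A $$ (i, j))"
  assume psd: "\<forall>x. 0 \<le> ?B x x" and det: "det A \<noteq> 0"
  note entry_sym = symmetric_entry[OF A sym]
  have "0 < ?B x x" if x: "i < d" "x i \<noteq> 0" for x i
  proof (rule ccontr)
    assume "\<not> ?thesis"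
    then have "?B x x = 0" using psd by (meson antisym not_less)
    then have zero: "?B y x = 0" for y :: "nat \<Rightarrow> real"
      using psd_cauchy_schwarz[of d "\<lambda>i j. A $$ (i, j)" y x] entry_sym psd by simp
    have "A *\<^sub>v Matrix.vec d x = 0\<^sub>v d"
    proof (rule eq_vecI)
      fix k assume k: "k < dim_vec (0\<^sub>v d)"
      have "(A *\<^sub>v Matrix.vec d x) $ k = (\<Sum>j<d. A $$ (k, j) * x j)"
        using A k by (simp add: scalar_prod_def lessThan_atLeast0)
      \<comment> \<open>Component \<open>k\<close> of \<open>A x\<close> is the value of the form at the \<open>k\<close>-th unit vector and \<open>x\<close>.\<close>
      also have "\<dots> = (\<Sum>i<d. if i = k then \<Sum>j<d. A $$ (i, j) * x j else 0)"
        using k by simp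
      also have "\<dots> = ?B (\<lambda>i. if i = k then 1 else 0) x"
        unfolding bilin_def by (intro sum.cong refl) simp
      finally show "(A *\<^sub>v Matrix.vec d x) $ k = 0\<^sub>v d $ k"
        using zero k by simp
    qed (use A in simp)
    then have "Matrix.vec d x = 0\<^sub>v d"
      using det_0_iff_vec_prod_zero[OF A] det vec_carrier by blast
    then show False using x by (simp add: vec_eq_0_iff)
  qed
  then show ?L
    using pos_def_mat_iff[OF A] sym by blast
qed

text \<open>
  The constant comes from the columns \<open>y\<^sub>k\<close> of the inverse: \<open>B(x, y\<^sub>k) = x\<^sub>k\<close>, so Cauchy-Schwarz bounds
  \<open>x\<^sub>k\<^sup>2\<close> by \<open>B(x, x) * B(y\<^sub>k, y\<^sub>k)\<close>. This replaces the usual compactness argument on the unit sphere.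
\<close>

lemma pos_def_coercive:
  assumes A: "A \<in> carrier_mat d d" and pd: "pos_def_mat A"
  obtains \<epsilon> where "\<epsilon> > 0" "\<And>x. \<epsilon> * (\<Sum>i<d. (x i)\<^sup>2) \<le> bilin d (\<lambda>i j. A $$ (i, j)) x x"
proof -
  let ?B = "bilin d (\<lambda>i j. A $$ (i, j))"
  have sym: "transpose_mat A = A"
    using pd unfolding pos_def_mat_def by blast
  have nonneg: "0 \<le> ?B x x" for x
    using pos_def_bilin_nonneg[OF pd A] .
  have "det A \<noteq> 0"
    using pos_def_mat_iff_psd_det[OF A sym] pd by blast
  then obtain A' where A': "A' \<in> carrier_mat d d" "A * A' = 1\<^sub>m d"
    using det_non_zero_imp_unit[OF A, of UNIV] unfolding Units_def by (auto simp: ring_mat_def)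
  define y where "y k = (\<lambda>i. A' $$ (i, k))" for k
  have dual: "?B x (y k) = x k" if "k < d" for x k
  proof -
    have "(\<Sum>j<d. A $$ (i, j) * y k j) = (if i = k then 1 else 0)" if "i < d" for i
    proof -
      have "(A * A') $$ (i, k) = (\<Sum>j<d. A $$ (i, j) * y k j)"
        using A A'(1) \<open>i < d\<close> \<open>k < d\<close> by (simp add: scalar_prod_def y_def lessThan_atLeast0)
      then show ?thesis
        unfolding A'(2) using \<open>i < d\<close> \<open>k < d\<close> by simp
    qed
    then have "?B x (y k) = (\<Sum>i<d. x i * (if i = k then 1 else 0))"
      unfolding bilin_def by (intro sum.cong refl) (simp add: sum_distrib_left mult_ac flip: sum_distrib_left)
    then show ?thesis using \<open>k < d\<close> by (simp add: if_distrib cong: if_cong)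
  qed
  define c where "c = (\<Sum>k<d. ?B (y k) (y k))"
  have "c \<ge> 0" unfolding c_def by (intro sum_nonneg nonneg)
  have bound: "(\<Sum>i<d. (x i)\<^sup>2) \<le> (1 + c) * ?B x x" for x
  proof -
    have "(\<Sum>i<d. (x i)\<^sup>2) \<le> (\<Sum>k<d. ?B x x * ?B (y k) (y k))"
    proof (rule sum_mono)
      fix k assume "k \<in> {..<d}"
      then show "(x k)\<^sup>2 \<le> ?B x x * ?B (y k) (y k)"
        using psd_cauchy_schwarz[of d "\<lambda>i j. A $$ (i, j)" x "y k"] dual[of k x]
          symmetric_entry[OF A sym] nonneg by simp
    qed
    also have "\<dots> = c * ?B x x" by (simp add: c_def sum_distrib_left mult.commute)
    also have "\<dots> \<le> (1 + c) * ?B x x" using nonneg by (simp add: distrib_right)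
    finally show ?thesis .
  qed
  show thesis
  proof (rule that[of "1 / (1 + c)"])
    show "1 / (1 + c) > 0" using \<open>c \<ge> 0\<close> by simp
    show "1 / (1 + c) * (\<Sum>i<d. (x i)\<^sup>2) \<le> ?B x x" for x
      using bound[of x] \<open>c \<ge> 0\<close> by (simp add: divide_le_eq mult.commute)
  qed
qed

lemma bilin_perturbation:
  "\<bar>bilin d h x x - bilin d g x x\<bar> \<le> (\<Sum>i<d. \<Sum>j<d. \<bar>h i j - g i j\<bar>) * (\<Sum>k<d. (x k)\<^sup>2)"
proof -
  define N where "N = (\<Sum>k<d. (x k)\<^sup>2)"
  have prod: "\<bar>x i * x j\<bar> \<le> N" if "i < d" "j < d" for i j
  proof -
    have sq: "(x i)\<^sup>2 \<le> N" if "i < d" for i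
      unfolding N_def by (rule member_le_sum) (use that in auto)
    have "0 \<le> (\<bar>x i\<bar> - \<bar>x j\<bar>)\<^sup>2" by simp
    then have "2 * \<bar>x i * x j\<bar> \<le> (x i)\<^sup>2 + (x j)\<^sup>2"
      by (simp add: power2_diff abs_mult)
    then show ?thesis using sq[OF that(1)] sq[OF that(2)] by simp
  qed
  have "\<bar>bilin d h x x - bilin d g x x\<bar> = \<bar>\<Sum>i<d. \<Sum>j<d. (h i j - g i j) * (x i * x j)\<bar>"
    by (simp add: bilin_def sum_subtractf[symmetric] algebra_simps)
  also have "\<dots> \<le> (\<Sum>i<d. \<bar>\<Sum>j<d. (h i j - g i j) * (x i * x j)\<bar>)"
    by (rule sum_abs)
  also have "\<dots> \<le> (\<Sum>i<d. \<Sum>j<d. \<bar>(h i j - g i j) * (x i * x j)\<bar>)"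
    by (intro sum_mono sum_abs)
  also have "\<dots> \<le> (\<Sum>i<d. \<Sum>j<d. \<bar>h i j - g i j\<bar> * N)"
    by (intro sum_mono) (simp add: abs_mult[of "_ - _"] mult_left_mono prod)
  finally show ?thesis by (simp add: sum_distrib_right N_def)
qed

lemma open_pos_def:
  fixes A :: "'a::topological_space \<Rightarrow> real mat"
  assumes A: "\<And>k. A k \<in> carrier_mat d d" and sym: "\<And>k. transpose_mat (A k) = A k"
    and cont: "\<And>i j. i < d \<Longrightarrow> j < d \<Longrightarrow> continuous_on UNIV (\<lambda>k. A k $$ (i, j))"
  shows "open {k. pos_def_mat (A k)}"
proof (subst open_subopen, safe)
  fix k0 assume "pos_def_mat (A k0)"
  then obtain \<epsilon> where \<epsilon>: "\<epsilon> > 0"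
    "\<And>x. \<epsilon> * (\<Sum>i<d. (x i)\<^sup>2) \<le> bilin d (\<lambda>i j. A k0 $$ (i, j)) x x"
    using pos_def_coercive[OF A] by metis
  define \<delta> where "\<delta> k = (\<Sum>i<d. \<Sum>j<d. \<bar>A k $$ (i, j) - A k0 $$ (i, j)\<bar>)" for k
  have "open {k. \<delta> k < \<epsilon>}"
    unfolding \<delta>_def by (intro open_Collect_less continuous_intros cont) auto
  moreover have "k0 \<in> {k. \<delta> k < \<epsilon>}"
    using \<epsilon>(1) by (simp add: \<delta>_def)
  moreover have "{k. \<delta> k < \<epsilon>} \<subseteq> {k. pos_def_mat (A k)}"
  proof safe
    fix k assume k: "\<delta> k < \<epsilon>"
    have "0 < bilin d (\<lambda>i j. A k $$ (i, j)) x x" if "i < d" "x i \<noteq> 0" for x i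
    proof -
      have "(x i)\<^sup>2 \<le> (\<Sum>i<d. (x i)\<^sup>2)"
        by (rule member_le_sum) (use that in auto)
      then have "0 < (\<Sum>i<d. (x i)\<^sup>2)"
        using that by (metis less_le_trans zero_less_power2)
      then have "0 < (\<epsilon> - \<delta> k) * (\<Sum>i<d. (x i)\<^sup>2)"
        using k by simp
      then show ?thesis
        using \<epsilon>(2)[of x] bilin_perturbation[of d "\<lambda>i j. A k $$ (i, j)" x "\<lambda>i j. A k0 $$ (i, j)"]
        unfolding \<delta>_def[symmetric] left_diff_distrib by linarith
    qed
    then show "pos_def_mat (A k)"
      using pos_def_mat_iff[OF A] sym by blast
  qed
  ultimately show "\<exists>T. open T \<and> k0 \<in> T \<and> T \<subseteq> {k. pos_def_mat (A k)}" by blast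
qed

text \<open>
  Along an affine pencil the positive definite locus is convex, hence connected, so it lies in a single
  component of the complement of the determinant curve. Inside that component it is open by coercivity
  and closed because there it coincides with the positive semidefinite locus; so it is the whole component.
\<close>

lemma affine_pencil_component:
  fixes A :: "'a::real_normed_vector \<Rightarrow> real mat"
  assumes A: "\<And>k. A k \<in> carrier_mat d d" and sym: "\<And>k. transpose_mat (A k) = A k"
    and cont: "\<And>i j. i < d \<Longrightarrow> j < d \<Longrightarrow> continuous_on UNIV (\<lambda>k. A k $$ (i, j))"
    and affine: "\<And>i j k l s t. i < d \<Longrightarrow> j < d \<Longrightarrow> s + t = 1 \<Longrightarrow>
      A (s *\<^sub>R k + t *\<^sub>R l) $$ (i, j) = s * A k $$ (i, j) + t * A l $$ (i, j)"
    and S: "S \<in> components {k. det (A k) \<noteq> 0}"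
    and k: "k \<in> S" "pos_def_mat (A k)"
  shows "S = {k. pos_def_mat (A k)}" "convex {k. pos_def_mat (A k)}"
proof -
  let ?L = "{k. pos_def_mat (A k)}"
  have iff: "?L = {k. det (A k) \<noteq> 0} \<inter> {k. \<forall>x. 0 \<le> bilin d (\<lambda>i j. A k $$ (i, j)) x x}"
    using pos_def_mat_iff_psd_det[OF A sym] by auto
  show cvx: "convex ?L"
    unfolding convex_def
  proof safe
    fix k l and s t :: real
    assume *: "pos_def_mat (A k)" "pos_def_mat (A l)" "0 \<le> s" "0 \<le> t" "s + t = 1"
    have "0 < bilin d (\<lambda>i j. A (s *\<^sub>R k + t *\<^sub>R l) $$ (i, j)) x x" if x: "i < d" "x i \<noteq> 0" for x i
    proof -
      have "bilin d (\<lambda>i j. A (s *\<^sub>R k + t *\<^sub>R l) $$ (i, j)) x x =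
          s * bilin d (\<lambda>i j. A k $$ (i, j)) x x + t * bilin d (\<lambda>i j. A l $$ (i, j)) x x"
        unfolding bilin_def sum_distrib_left sum.distrib[symmetric]
        by (intro sum.cong refl) (simp add: affine *(5) algebra_simps)
      moreover have "0 < bilin d (\<lambda>i j. A k $$ (i, j)) x x" "0 < bilin d (\<lambda>i j. A l $$ (i, j)) x x"
        using pos_def_bilin_pos[OF _ A] * x by blast+
      ultimately show ?thesis
        using *(3-5) by (cases "s = 0") (auto intro!: add_pos_nonneg)
    qed
    then show "pos_def_mat (A (s *\<^sub>R k + t *\<^sub>R l))"
      using pos_def_mat_iff[OF A] sym by blast
  qed
  have "?L \<subseteq> S"
    by (rule components_maximal[OF S]) (use convex_connected[OF cvx] k iff in auto)
  moreover have "S \<subseteq> ?L"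
  proof -
    have "closed {k. \<forall>x. 0 \<le> bilin d (\<lambda>i j. A k $$ (i, j)) x x}"
      unfolding bilin_def
      by (intro closed_Collect_all closed_Collect_le continuous_intros cont) auto
    moreover have "S \<inter> ?L = S \<inter> {k. \<forall>x. 0 \<le> bilin d (\<lambda>i j. A k $$ (i, j)) x x}"
      using iff in_components_subset[OF S] by blast
    ultimately have "closedin (top_of_set S) (S \<inter> ?L)"
      by (simp add: closedin_closed_Int)
    moreover have "openin (top_of_set S) (S \<inter> ?L)"
      using open_pos_def[OF A sym cont] by (rule openin_open_Int)
    ultimately have "S \<inter> ?L = {} \<or> S \<inter> ?L = S"
      using in_components_connected[OF S] by (metis connected_clopen)
    then show ?thesis using k by blast
  qed
  ultimately show "S = ?L" by blast
qed

section \<open>Continuity of roots and stability\<close>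

text \<open>
  A monic polynomial is the product of the \<open>z - r\<close> over its roots, so a small value at \<open>z\<close> forces
  a small factor. This gives the continuity of roots without Rouche's theorem.
\<close>

lemma monic_root_near:
  fixes f :: "complex poly"
  assumes "lead_coeff f = 1" "\<epsilon> > 0" "cmod (poly f z) < \<epsilon> ^ degree f"
  shows "\<exists>r. poly f r = 0 \<and> cmod (z - r) < \<epsilon>"
proof (rule ccontr)
  assume "\<not> ?thesis"
  then have far: "\<epsilon> \<le> cmod (z - r)" if "poly f r = 0" for r
    using that by force
  obtain A where A: "size A = degree f" "f = smult (lead_coeff f) (\<Prod>x\<in>#A. [:-x, 1:])"
    using alg_closed_imp_factorization assms(1) by (metis leading_coeff_0_iff zero_neq_one)
  have "f = (\<Prod>x\<in>#A. [:-x, 1:])"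
    using A(2) assms(1) by simp
  then have eval: "poly f y = (\<Prod>x\<in>#A. y - x)" for y
    by (simp add: poly_prod_mset)
  have "poly f x = 0" if "x \<in># A" for x
    unfolding eval using that by (simp add: prod_mset_zero_iff)
  then have "\<forall>x\<in>#A. \<epsilon> \<le> cmod (z - x)"
    using far by blast
  then have "\<epsilon> ^ size A \<le> cmod (\<Prod>x\<in>#A. z - x)"
    using assms(2) by (induction A) (auto simp: norm_mult intro: mult_mono)
  then show False
    using assms(3) eval A(1) by simp
qed

text \<open>
  The quotient tends to zero at infinity and is continuous on the compact remainder of \<open>C\<close>.
\<close>

lemma poly_ratio_bounded_on_closed:
  fixes f g :: "complex poly"
  assumes "degree g < degree f" "closed C" "\<And>z. z \<in> C \<Longrightarrow> poly f z \<noteq> 0"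
  obtains B where "B > 0" "\<And>z. z \<in> C \<Longrightarrow> cmod (poly g z) \<le> B * cmod (poly f z)"
proof -
  have "((\<lambda>z. poly g z / poly f z) \<longlongrightarrow> 0) at_infinity"
    by (rule poly_divide_tendsto_0_at_infinity[OF assms(1)])
  then have "eventually (\<lambda>z. cmod (poly g z / poly f z) < 1) at_infinity"
    by (auto simp: tendsto_iff dest: spec[of _ 1])
  then obtain R where R: "\<And>z. R \<le> cmod z \<Longrightarrow> cmod (poly g z / poly f z) < 1"
    unfolding eventually_at_infinity by auto
  have "compact (C \<inter> cball 0 R)"
    using assms(2) by (rule closed_Int_compact) simp
  then have "compact ((\<lambda>z. poly g z / poly f z) ` (C \<inter> cball 0 R))"
    by (intro compact_continuous_image continuous_intros) (use assms(3) in auto)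
  then have "bounded ((\<lambda>z. poly g z / poly f z) ` (C \<inter> cball 0 R))"
    by (rule compact_imp_bounded)
  then obtain B where "\<forall>y \<in> (\<lambda>z. poly g z / poly f z) ` (C \<inter> cball 0 R). cmod y \<le> B"
    unfolding bounded_iff by blast
  then have B: "cmod (poly g z / poly f z) \<le> B" if "z \<in> C" "cmod z \<le> R" for z
    using that by simp
  show thesis
  proof (rule that[of "max 1 B"])
    fix z assume z: "z \<in> C"
    then have "cmod (poly g z / poly f z) \<le> max 1 B"
      using R[of z] B[of z] by fastforce
    then show "cmod (poly g z) \<le> max 1 B * cmod (poly f z)"
      using assms(3)[OF z] by (simp add: norm_divide divide_le_eq)
  qed simp
qed

lemma cpoly_family:
  "cpoly (poly_family p0 p1 p2 k) z = cpoly p0 z + of_real (fst k) * cpoly p1 z + of_real (snd k) * cpoly p2 z"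
  by (simp add: poly_family_def cpoly_simps)

lemma poly_family_monic:
  assumes "lead_coeff p0 = 1" "degree p1 < degree p0" "degree p2 < degree p0"
  shows "degree (poly_family p0 p1 p2 k) = degree p0" "lead_coeff (poly_family p0 p1 p2 k) = 1"
proof -
  have small: "degree (smult c p) < degree p0" if "degree p < degree p0" for c p
    using that degree_smult_le by (rule le_less_trans[rotated])
  show deg: "degree (poly_family p0 p1 p2 k) = degree p0"
    unfolding poly_family_def using small[OF assms(2)] small[OF assms(3)]
    by (simp add: degree_add_eq_left del: degree_smult_eq)
  show "lead_coeff (poly_family p0 p1 p2 k) = 1"
    unfolding deg using assms by (simp add: poly_family_def coeff_eq_0)
qed

text \<open>
  The parameters in \<open>L\<close> with a root in the right half-plane form an open subset, because
  the roots of monic polynomials move continuously. The stable ones form an open subset too: on the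
  closed right half-plane \<open>p\<^sub>1\<close> and \<open>p\<^sub>2\<close> are bounded by a multiple of the modulus of a stable member of
  the family, so a small change of \<open>k\<close> cannot cancel it. As \<open>L\<close> has no parameter with a root on the
  imaginary axis, is connected and contains a stable parameter, the first subset is empty.
\<close>

lemma stability_spreads:
  assumes p: "lead_coeff p0 = 1" "degree p1 < degree p0" "degree p2 < degree p0"
    and L: "connected L" "k0 \<in> L" "stable_poly (poly_family p0 p1 p2 k0)"
    and no_root: "\<And>k \<omega>. k \<in> L \<Longrightarrow> cpoly (poly_family p0 p1 p2 k) (\<i> * of_real \<omega>) \<noteq> 0"
  shows "L \<subseteq> stability_region p0 p1 p2"
proof -
  define F where "F k = cpoly (poly_family p0 p1 p2 k)" for k
  note F = cpoly_family[of p0 p1 p2, folded F_def]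
  define U where "U = {k \<in> L. \<exists>z. Re z > 0 \<and> F k z = 0}"
  have Re_pos: "Re z > 0" if "k \<in> L" "F k z = 0" "\<not> Re z < 0" for k z
  proof (rule ccontr)
    assume "\<not> Re z > 0"
    then have "z = \<i> * of_real (Im z)" using that by (simp add: complex_eq_iff)
    then show False using no_root[OF that(1), of "Im z"] that(2) by (simp add: F_def)
  qed
  have U_iff: "k \<in> U \<longleftrightarrow> \<not> stable_poly (poly_family p0 p1 p2 k)" if "k \<in> L" for k
    using Re_pos[OF that] that unfolding U_def stable_poly_def F_def by fastforce
  have "openin (top_of_set L) U"
  proof (subst openin_subopen, safe)
    fix k assume "k \<in> U"
    then obtain z where z: "k \<in> L" "Re z > 0" "F k z = 0" unfolding U_def by blast
    define N where "N = {l. cmod (F l z) < Re z ^ degree p0}"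
    have "open N"
      unfolding N_def F by (intro open_Collect_less continuous_intros)
    moreover have "k \<in> N" using z by (simp add: N_def)
    moreover have "L \<inter> N \<subseteq> U"
    proof
      fix l assume l: "l \<in> L \<inter> N"
      have "\<exists>r. F l r = 0 \<and> cmod (z - r) < Re z"
        unfolding F_def
        by (rule monic_root_near) (use l z poly_family_monic[OF p] in \<open>auto simp: N_def F_def\<close>)
      then obtain r where "F l r = 0" "cmod (z - r) < Re z" by blast
      moreover from this have "Re r > 0"
        using abs_Re_le_cmod[of "z - r"] by simp
      ultimately show "l \<in> U" using l unfolding U_def by blast
    qed
    ultimately show "\<exists>T. openin (top_of_set L) T \<and> k \<in> T \<and> T \<subseteq> U"
      using z(1) openin_open_Int by blast
  qed
  moreover have "openin (top_of_set L) (L - U)"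
  proof (subst openin_subopen, safe)
    fix k assume k: "k \<in> L" "k \<notin> U"
    have nz: "F k z \<noteq> 0" if "z \<in> {z. 0 \<le> Re z}" for z
      using Re_pos[OF k(1)] k that unfolding U_def by fastforce
    have cl: "closed {z. 0 \<le> Re z}"
      by (intro closed_Collect_le continuous_intros)
    obtain B1 where B1: "B1 > 0" "\<And>z. 0 \<le> Re z \<Longrightarrow> cmod (cpoly p1 z) \<le> B1 * cmod (F k z)"
      using poly_ratio_bounded_on_closed[OF _ cl nz[unfolded F_def], of "map_poly of_real p1"]
        p poly_family_monic[OF p] by (auto simp: F_def)
    obtain B2 where B2: "B2 > 0" "\<And>z. 0 \<le> Re z \<Longrightarrow> cmod (cpoly p2 z) \<le> B2 * cmod (F k z)"
      using poly_ratio_bounded_on_closed[OF _ cl nz[unfolded F_def], of "map_poly of_real p2"]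
        p poly_family_monic[OF p] by (auto simp: F_def)
    define N where "N = {l. \<bar>fst l - fst k\<bar> * B1 + \<bar>snd l - snd k\<bar> * B2 < 1}"
    have "open N"
      unfolding N_def by (intro open_Collect_less continuous_intros)
    moreover have "k \<in> N" by (simp add: N_def)
    moreover have "L \<inter> N \<subseteq> L - U"
    proof
      fix l assume l: "l \<in> L \<inter> N"
      have "F l z \<noteq> 0" if z: "Re z > 0" for z
      proof
        assume "F l z = 0"
        then have "F k z = of_real (fst k - fst l) * cpoly p1 z + of_real (snd k - snd l) * cpoly p2 z"
          by (simp add: F algebra_simps)
        then have "cmod (F k z) \<le>
            \<bar>fst l - fst k\<bar> * cmod (cpoly p1 z) + \<bar>snd l - snd k\<bar> * cmod (cpoly p2 z)"
          by (metis (no_types) abs_minus_commute norm_mult norm_of_real norm_triangle_ineq)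
        also have "\<dots> \<le> \<bar>fst l - fst k\<bar> * (B1 * cmod (F k z)) + \<bar>snd l - snd k\<bar> * (B2 * cmod (F k z))"
          using B1(2) B2(2) z by (intro add_mono mult_left_mono) auto
        also have "\<dots> = (\<bar>fst l - fst k\<bar> * B1 + \<bar>snd l - snd k\<bar> * B2) * cmod (F k z)"
          by (simp add: algebra_simps)
        also have "\<dots> < 1 * cmod (F k z)"
          using l nz[of z] z by (intro mult_strict_right_mono) (auto simp: N_def)
        finally show False by simp
      qed
      then show "l \<in> L - U" using l unfolding U_def by blast
    qed
    ultimately show "\<exists>T. openin (top_of_set L) T \<and> k \<in> T \<and> T \<subseteq> L - U"
      using k(1) openin_open_Int by blast
  qed
  then have "closedin (top_of_set L) U"
    by (auto simp: closedin_def U_def)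
  ultimately have "U = {} \<or> U = L"
    using L(1) by (simp add: connected_clopen)
  then have "U = {}"
    using L U_iff by blast
  then show ?thesis
    using U_iff by (auto simp: stability_region_def)
qed

section \<open>The size of the pencil\<close>

lemma coprime_if_no_common_complex_root:
  assumes "\<And>z. \<not> (cpoly f z = 0 \<and> cpoly g z = 0)"
  shows "coprime f g"
proof (rule coprimeI)
  fix c assume "c dvd f" "c dvd g"
  then obtain f' g' where "f = c * f'" "g = c * g'" by (auto elim!: dvdE)
  then have "cpoly c z \<noteq> 0" for z
    using assms[of z] by (auto simp: cpoly_simps)
  then have "degree (map_poly complex_of_real c) = 0" "c \<noteq> 0"
    using alg_closed_imp_poly_has_root[of "map_poly complex_of_real c"] by fastforce+
  then show "is_unit c"
    by (simp add: is_unit_iff_degree)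
qed

text \<open>
  The hypothesis says that \<open>f(s) g(-s)\<close> is an even polynomial, so \<open>f(s) g(-s) = f(-s) g(s)\<close>. The roots of
  \<open>f(s)\<close> lie in the left and those of \<open>f(-s)\<close> in the right half-plane, so these two are coprime.
\<close>

lemma stable_dvd_if_proportional_parts:
  assumes f: "stable_poly f"
    and eq: "im_part f * re_part g = re_part f * im_part g"
  shows "f dvd g"
proof -
  define J X :: "real poly" where "J = [:0, 0, -1:]" and "X = [:0, 1:]"
  let ?f' = "f \<circ>\<^sub>p [:0, -1:]" and ?g' = "g \<circ>\<^sub>p [:0, -1:]"
  define E1 O1 E2 O2 where "E1 = re_part f \<circ>\<^sub>p J" and "O1 = im_part f \<circ>\<^sub>p J"
    and "E2 = re_part g \<circ>\<^sub>p J" and "O2 = im_part g \<circ>\<^sub>p J"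
  have dec: "f = E1 + X * O1" "g = E2 + X * O2" "?f' = E1 - X * O1" "?g' = E2 - X * O2"
    unfolding E1_def O1_def E2_def O2_def X_def J_def
    by (rule even_odd_decomposition reflected_even_odd_decomposition)+
  have cross: "O1 * E2 = E1 * O2"
    using arg_cong[OF eq, of "\<lambda>p. p \<circ>\<^sub>p J"] by (simp add: pcompose_mult E1_def O1_def E2_def O2_def)
  have "f * ?g' = E1 * E2 - X * X * (O1 * O2) + X * (O1 * E2 - E1 * O2)"
    unfolding dec(4) by (subst dec(1)) (simp add: algebra_simps)
  moreover have "?f' * g = E1 * E2 - X * X * (O1 * O2) - X * (O1 * E2 - E1 * O2)"
    unfolding dec(3) by (subst dec(2)) (simp add: algebra_simps)
  ultimately have "f * ?g' = ?f' * g"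
    using cross by simp
  then have "f dvd ?f' * g" by (metis dvd_triv_left)
  moreover have "coprime f ?f'"
  proof (rule coprime_if_no_common_complex_root)
    fix z
    have "cpoly ?f' z = cpoly f (- z)"
      by (simp add: cpoly_pcompose cpoly_pCons)
    then show "\<not> (cpoly f z = 0 \<and> cpoly ?f' z = 0)"
      using f unfolding stable_poly_def by (metis less_asym neg_less_0_iff_less uminus_complex.sel(1))
  qed
  ultimately show ?thesis
    using coprime_dvd_mult_right_iff[of f ?f' g] by blast
qed

abbreviation pencil_size :: "real poly \<Rightarrow> real poly \<Rightarrow> real poly \<Rightarrow> nat" where
  "pencil_size p0 p1 p2 \<equiv> max (degree (pencil_q0 p0 p1 p2))
     (max (degree (pencil_q1 p0 p1 p2)) (degree (pencil_q2 p0 p1 p2)))"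

text \<open>
  The block \<open>G\<close> is never empty in the presence of a stable member of the family. The vector
  \<open>(q\<^sub>0, q\<^sub>1, q\<^sub>2)\<close> is, up to sign, the cross product of \<open>(p\<^sub>i\<^sub>R)\<close> and \<open>(p\<^sub>i\<^sub>I)\<close>, hence orthogonal to both.
  If all \<open>q\<^sub>i\<close> were constant, this would be a linear relation \<open>c\<^sub>0 p\<^sub>0 + c\<^sub>1 p\<^sub>1 + c\<^sub>2 p\<^sub>2 = 0\<close>, which
  degrees and the ratio condition reduce to \<open>c\<^sub>0 = c\<^sub>1 = 0\<close>. Then the real and imaginary
  parts of \<open>p\<^sub>2\<close> and of the stable member are proportional, so the latter, of larger degree, divides \<open>p\<^sub>2\<close>.
\<close>

lemma pencil_size_pos:
  assumes p0: "lead_coeff p0 = 1" "degree p1 < degree p0" "degree p2 < degree p0"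
    and p12: "p2 \<noteq> 0" "\<And>c. p1 \<noteq> smult c p2"
    and stable: "stable_poly (poly_family p0 p1 p2 k)"
  shows "pencil_size p0 p1 p2 > 0"
proof (rule ccontr)
  assume "\<not> ?thesis"
  then obtain c0 c1 c2 where const: "pencil_q0 p0 p1 p2 = [:c0:]" "pencil_q1 p0 p1 p2 = [:c1:]"
      "pencil_q2 p0 p1 p2 = [:c2:]"
    by (metis degree_eq_zeroE max_less_iff_conj neq0_conv less_max_iff_disj)
  let ?p = "smult c0 p0 + smult c1 p1 + smult c2 p2"
  have "re_part ?p = pencil_q0 p0 p1 p2 * re_part p0 + pencil_q1 p0 p1 p2 * re_part p1 +
      pencil_q2 p0 p1 p2 * re_part p2"
    by (simp add: const re_im_part_linear)
  also have "\<dots> = 0"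
    by (simp add: pencil_q0_def pencil_q1_def pencil_q2_def algebra_simps)
  finally have "re_part ?p = 0" .
  moreover have "im_part ?p = pencil_q0 p0 p1 p2 * im_part p0 + pencil_q1 p0 p1 p2 * im_part p1 +
      pencil_q2 p0 p1 p2 * im_part p2"
    by (simp add: const re_im_part_linear)
  then have "im_part ?p = 0"
    by (simp add: pencil_q0_def pencil_q1_def pencil_q2_def algebra_simps)
  ultimately have rel: "?p = 0"
    by (subst even_odd_decomposition) simp
  \<comment> \<open>The coefficient at \<open>s ^ n\<close>, where \<open>n\<close> is the degree of the monic \<open>p0\<close>.\<close>
  have "c0 = 0"
    using arg_cong[OF rel, of "\<lambda>p. coeff p (degree p0)"] p0 by (simp add: coeff_eq_0)
  have "c1 = 0"
  proof (rule ccontr)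
    assume "c1 \<noteq> 0"
    then have "p1 = smult (1 / c1) (smult c1 p1)" by simp
    also have "smult c1 p1 = - smult c2 p2"
      using rel \<open>c0 = 0\<close> by (simp add: add_eq_0_iff)
    finally show False using p12(2)[of "- c2 / c1"] by simp
  qed
  let ?f = "poly_family p0 p1 p2 k"
  have "im_part ?f * re_part p2 - re_part ?f * im_part p2 =
      smult (fst k) (pencil_q0 p0 p1 p2) - pencil_q1 p0 p1 p2"
    by (simp add: poly_family_def re_im_part_linear pencil_q0_def pencil_q1_def algebra_simps
        smult_diff_right)
  then have "?f dvd p2"
    using \<open>c0 = 0\<close> \<open>c1 = 0\<close> const by (intro stable_dvd_if_proportional_parts stable) simp_all
  then show False
    using dvd_imp_degree_le[of ?f p2] p12(1) p0 poly_family_monic[OF p0, of k] by simp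
qed

section \<open>Entries of the pencil and roots on the imaginary axis\<close>

text \<open>
  Symmetry and affinity in \<open>k\<close> are read off entrywise, and the lower block appears here as one
  Bezoutian, so that the criterion on common real roots applies to it.
\<close>

lemma pencil_eq:
  fixes p0 p1 p2 k
  defines "q0 \<equiv> pencil_q0 p0 p1 p2" and "q1 \<equiv> pencil_q1 p0 p1 p2" and "q2 \<equiv> pencil_q2 p0 p1 p2"
    and "M \<equiv> pencil_size p0 p1 p2"
  shows "pencil p0 p1 p2 k = Matrix.mat (Suc M) (Suc M) (\<lambda>(i, j).
    case i of 0 \<Rightarrow> (case j of 0 \<Rightarrow> pencil_l p0 p1 p2 k | Suc _ \<Rightarrow> 0)
    | Suc i' \<Rightarrow> (case j of 0 \<Rightarrow> 0
        | Suc j' \<Rightarrow> bezout_coeff (q1 - smult (fst k) q0) (q2 - smult (snd k) q0) i' j'))"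
proof -
  have G: "pencil_G p0 p1 p2 k = Matrix.mat M M (\<lambda>(i, j).
      bezout_coeff (q1 - smult (fst k) q0) (q2 - smult (snd k) q0) i j)"
    unfolding pencil_G_def Let_def q0_def[symmetric] q1_def[symmetric] q2_def[symmetric]
      M_def[folded q0_def q1_def q2_def, symmetric]
    by (rule eq_matI) (simp_all add: bezoutian_of_size_def bezout_coeff_combination)
  show ?thesis
  proof (rule eq_matI, goal_cases)
    case (1 i j)
    then show ?case
      by (cases i; cases j) (simp_all add: pencil_def G Let_def)
  qed (simp_all add: pencil_def G Let_def)
qed

lemma pencil_carrier: "pencil p0 p1 p2 k \<in> carrier_mat (Suc (pencil_size p0 p1 p2)) (Suc (pencil_size p0 p1 p2))"
  unfolding pencil_eq by simp

lemma pencil_symmetric: "transpose_mat (pencil p0 p1 p2 k) = pencil p0 p1 p2 k"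
  unfolding pencil_eq by (rule eq_matI) (auto split: nat.split simp: bezout_coeff_sym)

lemma pencil_entry_affine:
  assumes "i < Suc (pencil_size p0 p1 p2)" "j < Suc (pencil_size p0 p1 p2)"
  obtains \<alpha> \<beta> \<gamma> where "\<And>k. pencil p0 p1 p2 k $$ (i, j) = \<alpha> + fst k * \<beta> + snd k * \<gamma>"
proof -
  have "\<exists>\<alpha> \<beta> \<gamma>. \<forall>k. pencil p0 p1 p2 k $$ (i, j) = \<alpha> + fst k * \<beta> + snd k * \<gamma>"
  proof (cases i; cases j)
    assume "i = 0" "j = 0"
    then show ?thesis using assms
      by (auto simp: pencil_eq pencil_l_def family_re_def poly_family_def simp del: mult_cancel_left)
  next
    fix i' j' assume ij: "i = Suc i'" "j = Suc j'"
    show ?thesis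
      by (rule exI[of _ "bezout_coeff (pencil_q1 p0 p1 p2) (pencil_q2 p0 p1 p2) i' j'"],
          rule exI[of _ "bezout_coeff (pencil_q2 p0 p1 p2) (pencil_q0 p0 p1 p2) i' j'"],
          rule exI[of _ "- bezout_coeff (pencil_q1 p0 p1 p2) (pencil_q0 p0 p1 p2) i' j'"])
        (use assms ij in \<open>simp add: pencil_eq bezout_coeff_combination\<close>)
  qed (use assms in \<open>auto simp: pencil_eq intro!: exI[of _ 0]\<close>)
  then show thesis using that by blast
qed

text \<open>
  A root at the origin makes \<open>l(k)\<close> vanish. A root \<open>\<i> \<omega>\<close> with \<open>\<omega> \<noteq> 0\<close> says that \<open>(1, k\<^sub>1, k\<^sub>2)\<close> is
  orthogonal to the vectors \<open>(p\<^sub>i\<^sub>R)\<close> and \<open>(p\<^sub>i\<^sub>I)\<close> at \<open>x = \<omega>\<^sup>2\<close>, so their cross product, which up to sign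
  is \<open>(q\<^sub>0, q\<^sub>1, q\<^sub>2)(x)\<close>, is a multiple of \<open>(1, k\<^sub>1, k\<^sub>2)\<close>. Hence \<open>q\<^sub>1 = k\<^sub>1 q\<^sub>0\<close> and \<open>q\<^sub>2 = k\<^sub>2 q\<^sub>0\<close> at \<open>x\<close>:
  the two polynomials whose Bezoutian is \<open>G(k)\<close> have a common real root.
\<close>

lemma pencil_pos_def_no_imaginary_root:
  assumes pd: "pos_def_mat (pencil p0 p1 p2 k)" and size: "pencil_size p0 p1 p2 > 0"
  shows "cpoly (poly_family p0 p1 p2 k) (\<i> * of_real \<omega>) \<noteq> 0"
proof
  let ?f = "poly_family p0 p1 p2 k" and ?M = "pencil_size p0 p1 p2"
  define x where "x = \<omega>\<^sup>2"
  define q0 q1 q2 where "q0 = pencil_q0 p0 p1 p2" and "q1 = pencil_q1 p0 p1 p2"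
    and "q2 = pencil_q2 p0 p1 p2"
  define a b where "a = q1 - smult (fst k) q0" and "b = q2 - smult (snd k) q0"
  assume root: "cpoly ?f (\<i> * of_real \<omega>) = 0"
  have re0: "poly (re_part ?f) x = 0"
    using poly_re_part[of ?f \<omega>] root by (simp add: x_def)
  note pos = pos_def_bilin_pos[OF pd pencil_carrier]
  have "\<omega> \<noteq> 0"
  proof
    assume "\<omega> = 0"
    then have "pencil_l p0 p1 p2 k = 0"
      using re0 by (simp add: pencil_l_def x_def flip: re_im_part_family)
    then show False
      using pos[of 0 "\<lambda>i. case i of 0 \<Rightarrow> 1 | Suc _ \<Rightarrow> 0"]
      by (simp add: bilin_def pencil_eq sum.lessThan_Suc_shift del: sum.lessThan_Suc)
  qed
  then have im0: "poly (im_part ?f) x = 0"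
    using poly_im_part[of \<omega> ?f] root by (simp add: x_def)
  have "degree a \<le> ?M" "degree b \<le> ?M"
    unfolding a_def b_def q0_def q1_def q2_def
    by (auto intro!: degree_diff_le order_trans[OF degree_smult_le])
  moreover have "0 < bilin ?M (bezout_coeff a b) y y" if "y 0 \<noteq> 0" for y
  proof -
    \<comment> \<open>Insert a vector supported on the block \<open>G\<close>; its entry \<open>y 0\<close> sits at index \<open>1\<close>, which
      is in range because \<open>G\<close> is not empty.\<close>
    have "0 < bilin (Suc ?M) (\<lambda>i j. pencil p0 p1 p2 k $$ (i, j)) (case_nat 0 y) (case_nat 0 y)"
      by (rule pos[of 1]) (use size that in auto)
    also have "\<dots> = bilin ?M (bezout_coeff a b) y y"
      by (simp add: bilin_def pencil_eq sum.lessThan_Suc_shift a_def b_def q0_def q1_def q2_def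
          del: sum.lessThan_Suc)
    finally show ?thesis .
  qed
  ultimately have "poly a x \<noteq> 0 \<or> poly b x \<noteq> 0"
    by (rule pos_def_bezoutian_no_common_real_root)
  moreover have R: "poly (re_part p0) x = - (fst k * poly (re_part p1) x + snd k * poly (re_part p2) x)"
    using re0 by (simp add: poly_family_def re_im_part_linear)
  have I: "poly (im_part p0) x = - (fst k * poly (im_part p1) x + snd k * poly (im_part p2) x)"
    using im0 by (simp add: poly_family_def re_im_part_linear)
  have "poly a x = 0" "poly b x = 0"
    unfolding a_def b_def q0_def q1_def q2_def pencil_q0_def pencil_q1_def pencil_q2_def
    by (simp_all add: R I) (simp_all add: algebra_simps)
  ultimately show False by simp
qed

section \<open>LMI components of the stability region\<close>

theorem corollary1:
  fixes n :: nat and p0 p1 p2 :: "real poly" and k :: "real \<times> real" and S :: "(real \<times> real) set"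
  assumes "n \<ge> 1"
    and "lead_coeff p0 = 1" and "degree p0 = n"
    and "degree p1 < n" and "degree p2 < n"
    and "p2 \<noteq> 0" and "\<nexists>c. to_fract p1 / to_fract p2 = to_fract [:c:]"
    and "S \<in> components (UNIV - pencil_curve p0 p1 p2)"
    and "k \<in> interior S"
    and "pos_def_mat (hermite_mat p0 p1 p2 k)"
    and "pos_def_mat (pencil p0 p1 p2 k)"
  shows "S = LMI_set p0 p1 p2 \<and> S \<subseteq> stability_region p0 p1 p2"
proof -
  have p: "lead_coeff p0 = 1" "degree p1 < degree p0" "degree p2 < degree p0"
    using assms by simp_all
  have ratio: "p1 \<noteq> smult c p2" for c
  proof
    assume "p1 = smult c p2"
    then have "to_fract p1 = to_fract [:c:] * to_fract p2"
      by (simp flip: to_fract_mult)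
    then have "to_fract p1 / to_fract p2 = to_fract [:c:]"
      using assms(6) by simp
    then show False using assms(7) by blast
  qed
  have "k \<in> S" using assms(9) interior_subset by blast
  have "{k. det (pencil p0 p1 p2 k) \<noteq> 0} = UNIV - pencil_curve p0 p1 p2"
    by (auto simp: pencil_curve_def)
  then have comp: "S \<in> components {k. det (pencil p0 p1 p2 k) \<noteq> 0}"
    using assms(8) by simp
  have cont: "continuous_on UNIV (\<lambda>k. pencil p0 p1 p2 k $$ (i, j))"
    and affine: "\<And>l m s t. s + t = 1 \<Longrightarrow> pencil p0 p1 p2 (s *\<^sub>R l + t *\<^sub>R m) $$ (i, j) =
        s * pencil p0 p1 p2 l $$ (i, j) + t * pencil p0 p1 p2 m $$ (i, j)"
    if ij: "i < Suc (pencil_size p0 p1 p2)" "j < Suc (pencil_size p0 p1 p2)" for i j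
  proof -
    obtain \<alpha> \<beta> \<gamma> where entry: "\<And>k. pencil p0 p1 p2 k $$ (i, j) = \<alpha> + fst k * \<beta> + snd k * \<gamma>"
      using pencil_entry_affine[OF ij] by blast
    show "continuous_on UNIV (\<lambda>k. pencil p0 p1 p2 k $$ (i, j))"
      unfolding entry by (intro continuous_intros)
    fix l m :: "real \<times> real" and s t :: real assume "s + t = 1"
    then have "\<alpha> = s * \<alpha> + t * \<alpha>" by (simp flip: distrib_right)
    then show "pencil p0 p1 p2 (s *\<^sub>R l + t *\<^sub>R m) $$ (i, j) =
        s * pencil p0 p1 p2 l $$ (i, j) + t * pencil p0 p1 p2 m $$ (i, j)"
      unfolding entry by (simp add: algebra_simps)
  qed
  have "S = {k. pos_def_mat (pencil p0 p1 p2 k)}" "convex {k. pos_def_mat (pencil p0 p1 p2 k)}"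
    by (rule affine_pencil_component[OF pencil_carrier pencil_symmetric cont affine comp
          \<open>k \<in> S\<close> assms(11)]; assumption)+
  then have S: "S = LMI_set p0 p1 p2" and conn: "connected S"
    by (auto simp: LMI_set_def convex_connected)
  have stable: "stable_poly (poly_family p0 p1 p2 k)"
    using hermite_criterion[of "poly_family p0 p1 p2 k", OF _ refl refl] assms(1,3,10)
      poly_family_monic(1)[OF p, of k]
    by (simp add: hermite_mat_def re_im_part_family)
  have "S \<subseteq> stability_region p0 p1 p2"
  proof (rule stability_spreads[OF p conn \<open>k \<in> S\<close> stable])
    fix l \<omega> assume "l \<in> S"
    then show "cpoly (poly_family p0 p1 p2 l) (\<i> * of_real \<omega>) \<noteq> 0"
      using pencil_pos_def_no_imaginary_root pencil_size_pos[OF p assms(6) ratio stable]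
      by (simp add: S LMI_set_def)
  qed
  with S show ?thesis by blast
qed

end
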